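(* For every integer $n\geq 4$, the gear $G_n$ satisfies $$\chi_{td}(G_n)=\begin{cases} 6 & n=4,5,\\ n+1 & n\text{ even and } n\geq 6,\\ n & n \text{ odd and } n\geq 7.\end{cases}$$
   Context: Graphs are finite, simple and undirected. For $n\geq 4$, the wheel $W_n$ is the graph on $n$ vertices obtained from the cycle $C_{n-1}$ on $n-1$ vertices (the outer circuit) by adding one vertex adjacent to all vertices of the cycle. The gear $G_n$ is formed from $W_n$ by subdividing each edge of the outer circuit into two edges (inserting one new degree-2 vertex on each outer-circuit edge). A total labeling of a graph $G$ is a function $f:V(G)\cup E(G)\to\mathbb{Z}^+$ (positive integers) such that $f(u)\neq f(v)$ for adjacent vertices $u,v$; $f(\{u,v\})\neq f(\{v,w\})$ for any two distinct incident edges $\{u,v\},\{v,w\}$; and $f(u)\neq f(\{u,v\})$ for every edge $\{u,v\}$ and incident vertex $u$. It is a $k$-total labeling if the maximum label assigned to any vertex or edge is $k$. A $k$-total difference labeling is a $k$-total labeling $f$ with $f(\{u,v\})=|f(u)-f(v)|$ for every edge $\{u,v\}$. The total difference chromatic number $\chi_{td}(G)$ is the smallest integer $k$ for which $G$ has a $k$-total difference labeling. *)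

theory Defs
  imports Main
begin

datatype 'a ugraph = UGraph (verts: "'a set") (edges: "'a set set")

definition simple_graph :: "'a ugraph \<Rightarrow> bool" where
  "simple_graph G \<longleftrightarrow> finite (verts G) \<and> (\<forall>e\<in>edges G. e \<subseteq> verts G \<and> card e = 2)"

(* A cycle only for m \<ge> 3. *)
definition cycle_graph :: "nat \<Rightarrow> nat ugraph" where
  "cycle_graph m = UGraph {..<m} {{i, Suc i mod m} | i. i < m}"

(* The vertex Some i of the wheel is the vertex i of the cycle, and None is the hub. *)
definition outer_circuit :: "nat \<Rightarrow> nat option set set" where
  "outer_circuit n = (\<lambda>e. Some ` e) ` edges (cycle_graph (n - 1))"

definition wheel_graph :: "nat \<Rightarrow> nat option ugraph" where
  "wheel_graph n = UGraph (insert None (Some ` verts (cycle_graph (n - 1))))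
     (outer_circuit n \<union> {{None, Some i} | i. i \<in> verts (cycle_graph (n - 1))})"

(* Subdivides once each edge in F \<subseteq> edges G. Inl v is the old vertex v, and Inr e is
   the new vertex of degree 2 placed on the edge e. *)
definition subdivide :: "'a ugraph \<Rightarrow> 'a set set \<Rightarrow> ('a + 'a set) ugraph" where
  "subdivide G F = UGraph (verts G <+> F)
     ((\<lambda>e. Inl ` e) ` (edges G - F) \<union> {{Inl v, Inr e} | v e. e \<in> F \<and> v \<in> e})"

definition gear_graph :: "nat \<Rightarrow> (nat option + nat option set) ugraph" where
  "gear_graph n = subdivide (wheel_graph n) (outer_circuit n)"

(* A labeling is a function on the disjoint union of vertices (Inl) and edges (Inr);
   its values outside verts G <+> edges G are irrelevant. *)
definition total_labeling :: "'a ugraph \<Rightarrow> ('a + 'a set \<Rightarrow> nat) \<Rightarrow> bool" where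
  "total_labeling G f \<longleftrightarrow>
     (\<forall>x\<in>verts G <+> edges G. f x > 0) \<and>
     (\<forall>u v. {u, v} \<in> edges G \<longrightarrow> f (Inl u) \<noteq> f (Inl v)) \<and>
     (\<forall>u v w. {u, v} \<in> edges G \<and> {v, w} \<in> edges G \<and> {u, v} \<noteq> {v, w}
        \<longrightarrow> f (Inr {u, v}) \<noteq> f (Inr {v, w})) \<and>
     (\<forall>u v. {u, v} \<in> edges G \<longrightarrow> f (Inl u) \<noteq> f (Inr {u, v}))"

definition k_total_labeling :: "'a ugraph \<Rightarrow> nat \<Rightarrow> ('a + 'a set \<Rightarrow> nat) \<Rightarrow> bool" where
  "k_total_labeling G k f \<longleftrightarrow> total_labeling G f \<and> Max (f ` (verts G <+> edges G)) = k"

definition k_total_difference_labeling ::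
  "'a ugraph \<Rightarrow> nat \<Rightarrow> ('a + 'a set \<Rightarrow> nat) \<Rightarrow> bool" where
  "k_total_difference_labeling G k f \<longleftrightarrow> k_total_labeling G k f \<and>
     (\<forall>u v. {u, v} \<in> edges G
        \<longrightarrow> int (f (Inr {u, v})) = \<bar>int (f (Inl u)) - int (f (Inl v))\<bar>)"

(* On nat, Inf is the minimum of a nonempty set and Inf {} = 0. For a graph with a vertex,
   a positive value therefore entails that a labeling exists. *)
definition total_difference_chromatic_number :: "'a ugraph \<Rightarrow> nat" where
  "total_difference_chromatic_number G = Inf {k. \<exists>f. k_total_difference_labeling G k f}"

lemma simple_graph_cycle_graph:
  assumes "m \<ge> 3"
  shows "simple_graph (cycle_graph m)"
proof -
  have "Suc i mod m \<noteq> i" "Suc i mod m < m" if "i < m" for i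
    using that assms by (cases "Suc i = m"; simp)+
  then show ?thesis
    by (fastforce simp: simple_graph_def cycle_graph_def card_2_iff)
qed

lemma simple_graph_wheel_graph:
  assumes "n \<ge> 4"
  shows "simple_graph (wheel_graph n)"
proof -
  have "simple_graph (cycle_graph (n - 1))"
    using assms by (intro simple_graph_cycle_graph) simp
  then show ?thesis
    by (auto simp: simple_graph_def wheel_graph_def outer_circuit_def card_image)
qed

lemma simple_graph_subdivide:
  assumes "simple_graph G" "F \<subseteq> edges G"
  shows "simple_graph (subdivide G F)"
proof -
  have "finite F"
    using assms by (meson PowI finite_Pow_iff finite_subset simple_graph_def subsetI subset_iff)
  then show ?thesis
    using assms by (fastforce simp: simple_graph_def subdivide_def card_image)
qed

lemma simple_graph_gear_graph:
  assumes "n \<ge> 4"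
  shows "simple_graph (gear_graph n)"
  unfolding gear_graph_def
  using assms by (intro simple_graph_subdivide simple_graph_wheel_graph) (auto simp: wheel_graph_def)

end

theory Submission
  imports Defs
begin

text \<open>
  A difference labeling is determined by its vertex labels: it exists iff adjacent labels are
  neither equal nor in ratio 2, and no path \<open>u, v, w\<close> has equal end labels or \<open>v\<close> as the midpoint
  of \<open>u\<close> and \<open>w\<close>. In a gear the hub and its \<open>n - 1\<close> neighbours carry distinct labels, so \<open>k \<ge> n\<close>.
  If \<open>k = n\<close>, every label other than the hub label \<open>c\<close> is on the rim, which forces \<open>c = n\<close>
  (otherwise the rim has the labels \<open>c - 1\<close> and \<open>c + 1\<close>, or the label 2 for \<open>c = 1\<close>);
  then \<open>n\<close> is odd, as \<open>c / 2\<close> is not allowed on the rim. Conversely, for \<open>n \<ge> 10\<close> take the odd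
  \<open>k \<in> {n, n + 1}\<close> as the hub label, put \<open>1, \<dots>, n - 1\<close> in order on the rim, and label the subdivision
  vertices greedily: at most 8 of the \<open>k - 1 \<ge> 10\<close> labels are excluded at each step.
\<close>

section \<open>Reduction to conditions on vertex labels\<close>

text \<open>For positive end labels of an edge: the difference |x - y| is nonzero and distinct from
  both x and y.\<close>

definition compatible :: "nat \<Rightarrow> nat \<Rightarrow> bool" where
  "compatible x y \<longleftrightarrow> x \<noteq> y \<and> x \<noteq> 2 * y \<and> y \<noteq> 2 * x"

text \<open>For two edges meeting in a vertex labeled y: |x - y| = |z - y| exactly if x = z or y is
  the midpoint of x and z.\<close>

definition no_midpoint :: "nat \<Rightarrow> nat \<Rightarrow> nat \<Rightarrow> bool" where
  "no_midpoint x y z \<longleftrightarrow> x \<noteq> z \<and> x + z \<noteq> 2 * y"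

lemma compatible_sym: "compatible x y \<longleftrightarrow> compatible y x"
  by (auto simp: compatible_def)

lemma no_midpoint_sym: "no_midpoint x y z \<longleftrightarrow> no_midpoint z y x"
  by (auto simp: no_midpoint_def)

text \<open>Here \<open>k\<close> is only a bound and need not be attained, which spares
  constructions any care about the maximum.\<close>

definition difference_vertex_labeling :: "'a ugraph \<Rightarrow> nat \<Rightarrow> ('a \<Rightarrow> nat) \<Rightarrow> bool" where
  "difference_vertex_labeling G k g \<longleftrightarrow>
     (\<forall>v\<in>verts G. 0 < g v \<and> g v \<le> k) \<and>
     (\<forall>u v. {u, v} \<in> edges G \<longrightarrow> compatible (g u) (g v)) \<and>
     (\<forall>u v w. {u, v} \<in> edges G \<and> {v, w} \<in> edges G \<and> u \<noteq> w \<longrightarrow> no_midpoint (g u) (g v) (g w))"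

lemma difference_vertex_labelingD:
  assumes "difference_vertex_labeling G k g"
  shows "v \<in> verts G \<Longrightarrow> 0 < g v"
    and "v \<in> verts G \<Longrightarrow> g v \<le> k"
    and "{u, v} \<in> edges G \<Longrightarrow> compatible (g u) (g v)"
    and "\<lbrakk>{u, v} \<in> edges G; {v, w} \<in> edges G; u \<noteq> w\<rbrakk> \<Longrightarrow> no_midpoint (g u) (g v) (g w)"
  using assms unfolding difference_vertex_labeling_def by simp_all

lemma finite_edges: "simple_graph G \<Longrightarrow> finite (edges G)"
  by (meson PowI finite_Pow_iff finite_subset simple_graph_def subsetI)

lemma difference_vertex_labeling_of_total:
  assumes G: "simple_graph G" and f: "k_total_difference_labeling G k f"
  shows "difference_vertex_labeling G k (f \<circ> Inl)"
proof -
  have fin: "finite (verts G <+> edges G)"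
    using G finite_edges by (auto simp: simple_graph_def)
  have max: "Max (f ` (verts G <+> edges G)) = k"
    and tot: "total_labeling G f"
    and diff: "\<And>u v. {u, v} \<in> edges G \<Longrightarrow> int (f (Inr {u, v})) = \<bar>int (f (Inl u)) - int (f (Inl v))\<bar>"
    using f by (auto simp: k_total_difference_labeling_def k_total_labeling_def)
  have verts: "0 < f (Inl v) \<and> f (Inl v) \<le> k" if "v \<in> verts G" for v
  proof -
    have "Inl v \<in> verts G <+> edges G"
      using that by (rule InlI)
    then show ?thesis
      using tot fin unfolding max[symmetric] total_labeling_def
      by (intro conjI Max_ge finite_imageI imageI) blast+
  qed
  have edge: "compatible (f (Inl u)) (f (Inl v))" if e: "{u, v} \<in> edges G" for u v
  proof -
    have e': "{v, u} \<in> edges G"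
      using e by (simp add: insert_commute)
    have "f (Inl u) \<noteq> f (Inl v)" "f (Inl u) \<noteq> f (Inr {u, v})" "f (Inl v) \<noteq> f (Inr {v, u})"
      using tot e e' unfolding total_labeling_def by blast+
    then show ?thesis
      using diff[OF e] diff[OF e'] by (auto simp: compatible_def)
  qed
  have path: "no_midpoint (f (Inl u)) (f (Inl v)) (f (Inl w))"
    if uv: "{u, v} \<in> edges G" and vw: "{v, w} \<in> edges G" and "u \<noteq> w" for u v w
  proof -
    have "{u, v} \<noteq> {v, w}"
      using \<open>u \<noteq> w\<close> by (auto simp: doubleton_eq_iff)
    then have "f (Inr {u, v}) \<noteq> f (Inr {v, w})"
      using tot uv vw unfolding total_labeling_def by blast
    then show ?thesis
      using diff[OF uv] diff[OF vw] by (auto simp: no_midpoint_def)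
  qed
  show ?thesis
    using verts edge path by (auto simp: difference_vertex_labeling_def)
qed

text \<open>Differences of labels in {1..k} are smaller than k, so the edge labels keep within the
  bound; the maximum k' may be smaller than k.\<close>

lemma total_of_difference_vertex_labeling:
  assumes G: "simple_graph G" "verts G \<noteq> {}" and g: "difference_vertex_labeling G k g"
  obtains k' f where "k' \<le> k" "k_total_difference_labeling G k' f"
proof
  \<comment> \<open>\<open>Max - Min\<close> over the set \<open>e\<close> is the absolute
    difference of the end labels, without choosing an order of the ends.\<close>
  define f where "f = case_sum g (\<lambda>e. Max (g ` e) - Min (g ` e))"
  let ?X = "verts G <+> edges G"
  have fv [simp]: "f (Inl v) = g v" for v
    by (simp add: f_def)
  have fe [simp]: "f (Inr {u, v}) = max (g u) (g v) - min (g u) (g v)" for u v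
    by (simp add: f_def)
  note vert = difference_vertex_labelingD(1,2)[OF g]
  have edge: "g u \<noteq> g v" "g u \<noteq> 2 * g v" "g v \<noteq> 2 * g u" if "{u, v} \<in> edges G" for u v
    using difference_vertex_labelingD(3)[OF g that] by (auto simp: compatible_def)
  have path: "g u \<noteq> g w" "g u + g w \<noteq> 2 * g v"
    if "{u, v} \<in> edges G" "{v, w} \<in> edges G" "u \<noteq> w" for u v w
    using difference_vertex_labelingD(4)[OF g that] by (auto simp: no_midpoint_def)
  have ends: "u \<in> verts G" "v \<in> verts G" if "{u, v} \<in> edges G" for u v
    using G that by (auto simp: simple_graph_def)
  have range: "0 < f x \<and> f x \<le> k" if x: "x \<in> ?X" for x
  proof (cases x)
    case (Inl v)
    then show ?thesis
      using x vert by auto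
  next
    case (Inr e)
    then have "e \<in> edges G"
      using x by auto
    moreover then obtain u v where "e = {u, v}"
      using G by (meson card_2_iff simple_graph_def)
    ultimately show ?thesis
      using Inr edge(1)[of u v] vert[OF ends(1), of u v] vert[OF ends(2), of u v] by auto
  qed
  have tot: "total_labeling G f"
    unfolding total_labeling_def
  proof (intro conjI ballI allI impI)
    fix u v w assume *: "{u, v} \<in> edges G \<and> {v, w} \<in> edges G \<and> {u, v} \<noteq> {v, w}"
    then have "u \<noteq> w"
      by auto
    then show "f (Inr {u, v}) \<noteq> f (Inr {v, w})"
      using * path[of u v w] by (auto simp: max_def min_def split: if_splits)
  next
    fix u v assume e: "{u, v} \<in> edges G"
    show "f (Inl u) \<noteq> f (Inr {u, v})"
      using edge[OF e] vert[OF ends(1)[OF e]] vert[OF ends(2)[OF e]]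
      by (auto simp: max_def min_def)
  qed (use range edge in auto)
  have "finite ?X" and "?X \<noteq> {}"
    using G finite_edges by (auto simp: simple_graph_def)
  then show "Max (f ` ?X) \<le> k"
    using range by (auto simp: Max_le_iff)
  show "k_total_difference_labeling G (Max (f ` ?X)) f"
    using tot by (auto simp: k_total_difference_labeling_def k_total_labeling_def)
qed

text \<open>The labeling obtained from \<open>g\<close> has some maximum k' \<le> k, and the lower
  bound forces k' = k.\<close>

lemma total_difference_chromatic_number_eqI:
  assumes G: "simple_graph G" "verts G \<noteq> {}"
    and "difference_vertex_labeling G k g"
    and lower: "\<And>k' g. difference_vertex_labeling G k' g \<Longrightarrow> k \<le> k'"
  shows "total_difference_chromatic_number G = k"
proof -
  obtain k' f where "k' \<le> k" and f: "k_total_difference_labeling G k' f"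
    using total_of_difference_vertex_labeling assms by blast
  moreover have ge: "k \<le> j" if "k_total_difference_labeling G j h" for j h
    using lower difference_vertex_labeling_of_total[OF G(1) that] .
  ultimately have "k_total_difference_labeling G k f"
    by (metis le_antisym)
  then show ?thesis
    unfolding total_difference_chromatic_number_def
    using ge by (intro cInf_eq_minimum) auto
qed

subsection \<open>Labels of gears\<close>

definition sub_vertex :: "nat \<Rightarrow> nat \<Rightarrow> nat option + nat option set" where
  "sub_vertex m i = Inr {Some i, Some (Suc i mod m)}"

text \<open>Distinct indices giving the same edge would be successors of each other, which a circuit
  of length at least 3 does not allow.\<close>

lemma sub_vertex_inj:
  assumes "3 \<le> m" "i < m" "j < m" "sub_vertex m i = sub_vertex m j"
  shows "i = j"
proof (rule ccontr)
  assume "i \<noteq> j"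
  then have "Suc j mod m = i" "Suc i mod m = j"
    using assms(4) unfolding sub_vertex_def sum.inject doubleton_eq_iff by blast+
  then show False
    using assms(1-3) by (simp add: mod_Suc split: if_splits)
qed

lemma Suc_mod_inj: "\<lbrakk>i < m; j < m; Suc i mod m = Suc j mod m\<rbrakk> \<Longrightarrow> i = j"
  by (simp add: mod_Suc split: if_splits)

lemma outer_circuit_eq:
  "outer_circuit n = (\<lambda>i. {Some i, Some (Suc i mod (n - 1))}) ` {..<n - 1}"
proof -
  have "edges (cycle_graph (n - 1)) = (\<lambda>i. {i, Suc i mod (n - 1)}) ` {..<n - 1}"
    by (simp add: cycle_graph_def) blast
  then show ?thesis
    by (simp add: outer_circuit_def image_image)
qed

lemma verts_gear_graph:
  "verts (gear_graph n) = insert (Inl None)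
     ((\<lambda>i. Inl (Some i)) ` {..<n - 1} \<union> sub_vertex (n - 1) ` {..<n - 1})"
  by (auto simp: gear_graph_def subdivide_def wheel_graph_def outer_circuit_eq cycle_graph_def
      sub_vertex_def)

lemma edges_gear_graph:
  "edges (gear_graph n) =
     (\<Union>i<n - 1. {{Inl None, Inl (Some i)}, {Inl (Some i), sub_vertex (n - 1) i},
        {Inl (Some (Suc i mod (n - 1))), sub_vertex (n - 1) i}})" (is "_ = ?R")
proof -
  let ?spokes = "(\<lambda>i. {None, Some i}) ` {..<n - 1}"
  have "edges (wheel_graph n) = outer_circuit n \<union> ?spokes"
    by (simp add: wheel_graph_def cycle_graph_def) blast
  \<comment> \<open>Only spokes contain the hub \<open>None\<close>, so removing the circuit edges
    leaves all spokes.\<close>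
  moreover have "outer_circuit n \<inter> ?spokes = {}"
    by (auto simp: outer_circuit_eq)
  ultimately have spokes: "edges (wheel_graph n) - outer_circuit n = ?spokes"
    by blast
  have "{{Inl v, Inr e} | v e. e \<in> outer_circuit n \<and> v \<in> e} =
      (\<Union>e\<in>outer_circuit n. (\<lambda>v. {Inl v, Inr e}) ` e)"
    by blast
  then have "edges (gear_graph n) =
      (\<lambda>e. Inl ` e) ` ?spokes \<union> (\<Union>e\<in>outer_circuit n. (\<lambda>v. {Inl v, Inr e}) ` e)"
    by (simp add: gear_graph_def subdivide_def spokes)
  also have "\<dots> = ?R"
    by (simp add: outer_circuit_eq sub_vertex_def image_image) blast
  finally show ?thesis .
qed

text \<open>
  The hub has the label \<open>c\<close>, vertex \<open>i\<close> of the outer circuit the label \<open>r i\<close>, and the vertex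
  subdividing the edge from \<open>i\<close> to its successor the label \<open>s i\<close>.
\<close>

definition gear_labels :: "nat \<Rightarrow> nat \<Rightarrow> nat \<Rightarrow> (nat \<Rightarrow> nat) \<Rightarrow> (nat \<Rightarrow> nat) \<Rightarrow> bool" where
  "gear_labels m k c r s \<longleftrightarrow> 0 < c \<and> c \<le> k \<and>
     (\<forall>i<m. 0 < r i \<and> r i \<le> k \<and> 0 < s i \<and> s i \<le> k \<and>
        compatible c (r i) \<and> compatible (r i) (s i) \<and> compatible (r (Suc i mod m)) (s i) \<and>
        no_midpoint (r i) (s i) (r (Suc i mod m)) \<and>
        no_midpoint c (r i) (s i) \<and> no_midpoint c (r (Suc i mod m)) (s i) \<and>
        no_midpoint (s i) (r (Suc i mod m)) (s (Suc i mod m))) \<and>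
     (\<forall>i<m. \<forall>j<i. no_midpoint (r i) c (r j))"

lemma gear_labels_hub_no_midpoint:
  assumes "gear_labels m k c r s" "i < m" "j < m" "i \<noteq> j"
  shows "no_midpoint (r i) c (r j)"
proof -
  have "no_midpoint (r i) c (r j)" if "i < m" "j < i" for i j
    using assms(1) that by (simp add: gear_labels_def)
  then show ?thesis
    using assms no_midpoint_sym by (metis nat_neq_iff)
qed

lemma gear_labels_of_vertex_labeling:
  assumes n: "4 \<le> n" and g: "difference_vertex_labeling (gear_graph n) k g"
  shows "gear_labels (n - 1) k (g (Inl None)) (\<lambda>i. g (Inl (Some i))) (\<lambda>i. g (sub_vertex (n - 1) i))"
proof -
  define m where "m = n - 1"
  let ?E = "edges (gear_graph n)"
  have m: "3 \<le> m"
    using n by (simp add: m_def)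
  note verts = verts_gear_graph[of n, folded m_def]
    and edges = edges_gear_graph[of n, folded m_def]
  note v = difference_vertex_labelingD(1,2)[OF g]
    and e = difference_vertex_labelingD(3)[OF g]
    and p = difference_vertex_labelingD(4)[OF g]
  have E: "{Inl None, Inl (Some i)} \<in> ?E" "{Inl (Some i), sub_vertex m i} \<in> ?E"
    "{Inl (Some (Suc i mod m)), sub_vertex m i} \<in> ?E" if "i < m" for i
    using that unfolding edges by blast+
  have E': "{Inl (Some i), Inl None} \<in> ?E" "{sub_vertex m i, Inl (Some i)} \<in> ?E"
    "{sub_vertex m i, Inl (Some (Suc i mod m))} \<in> ?E" if "i < m" for i
    using E[OF that] by (simp_all add: insert_commute)
  \<comment> \<open>Path conditions need distinct ends; as m \<ge> 3, consecutive rim vertices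
    differ, and so do consecutive subdivision vertices.\<close>
  have S: "Suc i mod m < m" "Suc i mod m \<noteq> i"
    "sub_vertex m (Suc i mod m) \<noteq> sub_vertex m i" if "i < m" for i
  proof -
    show *: "Suc i mod m < m" "Suc i mod m \<noteq> i"
      using m that by (cases "Suc i = m"; simp)+
    then show "sub_vertex m (Suc i mod m) \<noteq> sub_vertex m i"
      using sub_vertex_inj[OF m] that by blast
  qed
  have ne: "Inl None \<noteq> sub_vertex m i" for i
    by (simp add: sub_vertex_def)
  show ?thesis
    unfolding gear_labels_def m_def[symmetric]
  proof (intro conjI allI impI)
    fix i assume i: "i < m"
    show "no_midpoint (g (Inl (Some i))) (g (sub_vertex m i)) (g (Inl (Some (Suc i mod m))))"
      using S(2)[OF i] by (intro p E E' i) simp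
    show "no_midpoint (g (Inl None)) (g (Inl (Some i))) (g (sub_vertex m i))"
      by (intro p E E' i ne)
    show "no_midpoint (g (Inl None)) (g (Inl (Some (Suc i mod m)))) (g (sub_vertex m i))"
      by (intro p E E' i S ne)
    show "no_midpoint (g (sub_vertex m i)) (g (Inl (Some (Suc i mod m))))
        (g (sub_vertex m (Suc i mod m)))"
      using S(3)[OF i] by (intro p E E' i S) simp
    fix j assume "j < i"
    then show "no_midpoint (g (Inl (Some i))) (g (Inl None)) (g (Inl (Some j)))"
      using i by (intro p E E') auto
  qed (auto intro!: v e E E' simp: verts)
qed

lemma vertex_labeling_of_gear_labels:
  assumes n: "4 \<le> n" and l: "gear_labels (n - 1) k c r s"
  shows "\<exists>g. difference_vertex_labeling (gear_graph n) k g"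
proof -
  define m where "m = n - 1"
  let ?E = "edges (gear_graph n)"
  have m: "3 \<le> m"
    using n by (simp add: m_def)
  note l = l[folded m_def]
    and verts = verts_gear_graph[of n, folded m_def]
    and edges = edges_gear_graph[of n, folded m_def]
  \<comment> \<open>A subdivision vertex carries a circuit edge, not an index; the index is
    recovered by \<open>THE\<close>, unique by \<open>sub_vertex_inj\<close>.\<close>
  define g where "g = (\<lambda>v. case v of Inl None \<Rightarrow> c | Inl (Some i) \<Rightarrow> r i
     | Inr e \<Rightarrow> s (THE i. i < m \<and> Inr e = sub_vertex m i))"
  have g [simp]: "g (Inl None) = c" "\<And>i. g (Inl (Some i)) = r i"
    by (auto simp: g_def)
  have gs [simp]: "g (sub_vertex m i) = s i" if "i < m" for i
  proof -
    have "(THE j. j < m \<and> sub_vertex m i = sub_vertex m j) = i"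
      using that sub_vertex_inj[OF m] by (intro the_equality) auto
    then show ?thesis
      by (simp add: g_def sub_vertex_def)
  qed
  have ne [simp]: "Inl v \<noteq> sub_vertex m i" "sub_vertex m i \<noteq> Inl v" for v i
    by (auto simp: sub_vertex_def)
  have S: "Suc i mod m < m" if "i < m" for i
    using m by simp
  have edge: "{u, v} \<in> ?E \<longleftrightarrow> (\<exists>i<m.
      u = Inl None \<and> v = Inl (Some i) \<or> u = Inl (Some i) \<and> v = Inl None \<or>
      u = Inl (Some i) \<and> v = sub_vertex m i \<or> u = sub_vertex m i \<and> v = Inl (Some i) \<or>
      u = Inl (Some (Suc i mod m)) \<and> v = sub_vertex m i \<or>
      u = sub_vertex m i \<and> v = Inl (Some (Suc i mod m)))" for u v
    by (simp only: edges UN_iff insert_iff empty_iff doubleton_eq_iff Bex_def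
        lessThan_iff disj_assoc simp_thms)
  have v: "\<forall>v\<in>verts (gear_graph n). 0 < g v \<and> g v \<le> k"
    using l by (auto simp: verts gear_labels_def)
  have e: "compatible (g u) (g v)" if "{u, v} \<in> ?E" for u v
    using that l unfolding edge gear_labels_def by (auto simp: compatible_sym)
  have sub: "no_midpoint (g u) (g (sub_vertex m i)) (g w)"
    if "{u, sub_vertex m i} \<in> ?E" "{sub_vertex m i, w} \<in> ?E" "u \<noteq> w" and i: "i < m" for u w i
  proof -
    have "x = Inl (Some i) \<or> x = Inl (Some (Suc i mod m))"
      if "{x, sub_vertex m i} \<in> ?E \<or> {sub_vertex m i, x} \<in> ?E" for x
      using that sub_vertex_inj[OF m i] unfolding edge by auto
    then have "u = Inl (Some i) \<or> u = Inl (Some (Suc i mod m))"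
      "w = Inl (Some i) \<or> w = Inl (Some (Suc i mod m))"
      using that(1,2) by blast+
    moreover have "no_midpoint (r i) (s i) (r (Suc i mod m))"
      using l i by (auto simp: gear_labels_def)
    ultimately show ?thesis
      using \<open>u \<noteq> w\<close> i by (auto simp: no_midpoint_sym)
  qed
  have hub: "no_midpoint (g u) (g (Inl None)) (g w)"
    if u: "{u, Inl None} \<in> ?E" and w: "{Inl None, w} \<in> ?E" and "u \<noteq> w" for u w
  proof -
    have "\<exists>i<m. x = Inl (Some i)" if "{x, Inl None} \<in> ?E \<or> {Inl None, x} \<in> ?E" for x
      using that unfolding edge by auto
    then obtain i j where "u = Inl (Some i)" "w = Inl (Some j)" "i < m" "j < m"
      using u w by blast
    moreover from this have "i \<noteq> j"
      using \<open>u \<noteq> w\<close> by blast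
    ultimately show ?thesis
      using gear_labels_hub_no_midpoint[OF l] by simp
  qed
  have rim: "no_midpoint (g u) (r j) (g w)"
    if u: "{Inl (Some j), u} \<in> ?E" and w: "{Inl (Some j), w} \<in> ?E" and "u \<noteq> w" for u w j
  proof -
    \<comment> \<open>The predecessor of \<open>j\<close> on the circuit. It is unspecified for j
      \<ge> m, hence the guards in \<open>nb\<close>.\<close>
    define p where "p = (THE i. i < m \<and> Suc i mod m = j)"
    have p: "p = i" if "i < m" "Suc i mod m = j" for i
      unfolding p_def using that Suc_mod_inj by (intro the_equality) blast+
    have nb: "x = Inl None \<or> j < m \<and> x = sub_vertex m j \<or>
        p < m \<and> Suc p mod m = j \<and> x = sub_vertex m p"
      if "{Inl (Some j), x} \<in> ?E" for x
      using that p unfolding edge by auto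
    have "no_midpoint c (r i) (s i)" "no_midpoint c (r (Suc i mod m)) (s i)"
      "no_midpoint (s i) (r (Suc i mod m)) (s (Suc i mod m))" if "i < m" for i
      using l that by (simp_all add: gear_labels_def)
    note L = this(1)[of j] this(2,3)[of p]
    note L' = L[THEN no_midpoint_sym[THEN iffD1]]
    show ?thesis
      using nb[OF u] nb[OF w] \<open>u \<noteq> w\<close> L L' by (elim disjE conjE) simp_all
  qed
  have "no_midpoint (g u) (g x) (g w)"
    if u: "{u, x} \<in> ?E" and w: "{x, w} \<in> ?E" and "u \<noteq> w" for u x w
  proof -
    consider "x = Inl None" | j where "x = Inl (Some j)" | i where "i < m" "x = sub_vertex m i"
      using u unfolding edge by auto
    then show ?thesis
    proof cases
      case 1
      then show ?thesis
        using hub that by blast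
    next
      case (2 j)
      then show ?thesis
        using rim[of j u w] that by (simp add: insert_commute)
    next
      case (3 i)
      then show ?thesis
        using sub that by blast
    qed
  qed
  then show ?thesis
    unfolding difference_vertex_labeling_def using v e by blast
qed

lemma total_difference_chromatic_number_gear_eqI:
  assumes n: "4 \<le> n" and "gear_labels (n - 1) k c r s"
    and lower: "\<And>k' c r s. gear_labels (n - 1) k' c r s \<Longrightarrow> k \<le> k'"
  shows "total_difference_chromatic_number (gear_graph n) = k"
proof -
  obtain g where "difference_vertex_labeling (gear_graph n) k g"
    using vertex_labeling_of_gear_labels assms by blast
  moreover have "verts (gear_graph n) \<noteq> {}"
    by (simp add: verts_gear_graph)
  ultimately show ?thesis
    using simple_graph_gear_graph[OF n] lower gear_labels_of_vertex_labeling[OF n]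
    by (intro total_difference_chromatic_number_eqI) blast+
qed

subsection \<open>Lower bounds\<close>

text \<open>Any two rim vertices are the ends of a path through the hub.\<close>

lemma gear_labels_inj:
  assumes "gear_labels m k c r s"
  shows "inj_on r {..<m}"
  using gear_labels_hub_no_midpoint[OF assms]
  unfolding inj_on_def no_midpoint_def lessThan_iff by blast

lemma gear_labels_reflect:
  assumes "gear_labels m k c r s" "i < m" "j < m" "i \<noteq> j"
  shows "r i + r j \<noteq> 2 * c"
  using gear_labels_hub_no_midpoint[OF assms] by (simp add: no_midpoint_def)

lemma gear_labels_hub:
  assumes "gear_labels m k c r s"
  shows "r ` {..<m} \<subseteq> {1..k} - {c, 2 * c}" "\<And>i. i < m \<Longrightarrow> c \<noteq> 2 * r i"
  using assms by (auto simp: gear_labels_def compatible_def Suc_le_eq)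

lemma gear_labels_ge:
  assumes "gear_labels m k c r s"
  shows "m + 1 \<le> k"
proof -
  have "card (r ` {..<m}) \<le> card ({1..k} - {c})"
    using gear_labels_hub(1)[OF assms] by (intro card_mono) auto
  moreover have "c \<in> {1..k}"
    using assms by (auto simp: gear_labels_def)
  ultimately show ?thesis
    using card_image[OF gear_labels_inj[OF assms]] by (cases k) auto
qed

lemma gear_labels_tight:
  assumes l: "gear_labels m (m + 1) c r s" and "3 \<le> m"
  shows "c = m + 1" "r ` {..<m} = {1..m}"
proof -
  have c: "c \<in> {1..m + 1}"
    using l by (auto simp: gear_labels_def)
  \<comment> \<open>The m distinct rim labels lie in a set of m elements and therefore exhaust
    it.\<close>
  have img: "r ` {..<m} = {1..m + 1} - {c}"
    using gear_labels_hub(1)[OF l] card_image[OF gear_labels_inj[OF l]] c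
    by (intro card_subset_eq) auto
  show "c = m + 1"
  proof (rule ccontr)
    assume ne: "c \<noteq> m + 1"
    show False
    proof (cases "c = 1")
      case True
      then have "2 * c \<in> r ` {..<m}"
        using img \<open>3 \<le> m\<close> by auto
      then show False
        using gear_labels_hub(1)[OF l] by auto
    next
      case False
      then have "c - 1 \<in> r ` {..<m}" "c + 1 \<in> r ` {..<m}"
        unfolding img using c ne by auto
      then obtain i j where ij: "i < m" "j < m" "r i = c - 1" "r j = c + 1"
        by (metis imageE lessThan_iff)
      then have "i \<noteq> j" "r i + r j = 2 * c"
        using c by auto
      then show False
        using gear_labels_reflect[OF l] ij by blast
    qed
  qed
  then show "r ` {..<m} = {1..m}"
    unfolding img by auto
qed

lemma gear_labels_odd_ge:
  assumes l: "gear_labels m k c r s" and "3 \<le> m" "odd m"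
  shows "m + 2 \<le> k"
proof (rule ccontr)
  assume "\<not> m + 2 \<le> k"
  then have "k = m + 1"
    using gear_labels_ge[OF l] by simp
  then have "c = m + 1" "r ` {..<m} = {1..m}"
    using gear_labels_tight[of m c r s] l \<open>3 \<le> m\<close> by simp_all
  then have "c div 2 \<in> r ` {..<m}" "even c"
    using \<open>odd m\<close> by (auto elim!: oddE)
  then show False
    using gear_labels_hub(2)[OF l] by auto
qed

section \<open>The exceptional rims with 3 and 4 vertices\<close>

text \<open>1 and 5 are reflections of each other in 3, so either hub label bars both from the
  subdivision vertices beside a rim label 3.\<close>

lemma gear_labels_rim_ne_3:
  assumes l: "gear_labels m k c r s" and "2 \<le> m" "k \<le> 5" "c = 1 \<or> c = 5" "i < m"
  shows "r i \<noteq> 3"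
proof
  assume r: "r i = 3"
  define j where "j = (if i = 0 then m - 1 else i - 1)"
  have j: "j < m" "Suc j mod m = i"
    using assms(2,5) by (auto simp: j_def)
  have s: "0 < s x" "s x \<le> k" "compatible (r x) (s x)" "compatible (r (Suc x mod m)) (s x)"
    "no_midpoint c (r x) (s x)" "no_midpoint c (r (Suc x mod m)) (s x)"
    "no_midpoint (s x) (r (Suc x mod m)) (s (Suc x mod m))" if "x < m" for x
    using l that by (simp_all add: gear_labels_def)
  \<comment> \<open>Only 2 and 4 remain for the two subdivision vertices next to the label 3, and 3 is their midpoint.\<close>
  have two_or_four: "x = 2 \<or> x = 4"
    if "0 < x" "x \<le> k" "compatible 3 x" "no_midpoint c 3 x" for x
    using that assms(3,4) unfolding compatible_def no_midpoint_def by presburger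
  have "s i = 2 \<or> s i = 4"
    using s[OF \<open>i < m\<close>] r by (intro two_or_four) simp_all
  moreover have "s j = 2 \<or> s j = 4"
    using s[OF j(1)] j r by (intro two_or_four) simp_all
  moreover have "no_midpoint (s j) 3 (s i)"
    using s(7)[OF j(1)] j r by simp
  ultimately show False
    by (auto simp: no_midpoint_def)
qed

text \<open>The tight case k = 5 puts 5 on the hub and all of 1, ..., 4 on the rim, including the
  excluded 3.\<close>

lemma gear_labels_4_ge:
  assumes l: "gear_labels 4 k c r s"
  shows "6 \<le> k"
proof (rule ccontr)
  assume "\<not> 6 \<le> k"
  then have k: "k = 4 + 1"
    using gear_labels_ge[OF l] by simp
  then have "c = 5" "3 \<in> r ` {..<4}"
    using gear_labels_tight[of 4 c r s] l by auto
  then show False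
    using gear_labels_rim_ne_3[OF l] k by force
qed

text \<open>For k \<le> 5, each hub label leaves rim labels that split into two classes, neither of
  which can serve two rim vertices.\<close>

lemma gear_labels_3_ge:
  assumes l: "gear_labels 3 k c r s"
  shows "6 \<le> k"
proof (rule ccontr)
  assume "\<not> 6 \<le> k"
  then have k: "k \<le> 5"
    by simp
  have c: "c = 1 \<or> c = 2 \<or> c = 3 \<or> c = 4 \<or> c = 5"
    using l k by (auto simp: gear_labels_def)
  have dist: "r i \<noteq> r j" and sums: "r i + r j \<noteq> 2 * c" if "i < 3" "j < 3" "i \<noteq> j" for i j
    using that inj_on_eq_iff[OF gear_labels_inj[OF l]] gear_labels_reflect[OF l] by simp_all
  \<comment> \<open>Pigeonhole: two of the three rim labels must lie on the same side of any bipartition.\<close>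
  have two_alike: False if "\<And>i j. \<lbrakk>i < 3; j < 3; i \<noteq> j\<rbrakk> \<Longrightarrow> Q (r i) \<noteq> Q (r j)" for Q :: "nat \<Rightarrow> bool"
    using that[of 0 1] that[of 1 2] that[of 0 2] by simp
  have rng: "r i \<in> {1, 2, 3, 4, 5} \<and> r i \<noteq> c \<and> r i \<noteq> 2 * c \<and> c \<noteq> 2 * r i \<and>
      (c = 1 \<or> c = 5 \<longrightarrow> r i \<noteq> 3)" if "i < 3" for i
  proof -
    have "r i \<in> {1..5}" "r i \<noteq> c" "r i \<noteq> 2 * c"
      using that gear_labels_hub(1)[OF l] k by fastforce+
    then show ?thesis
      using that gear_labels_hub(2)[OF l] gear_labels_rim_ne_3[OF l _ k] by force
  qed
  have c5: "c = 5"
  proof (rule ccontr)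
    assume "c \<noteq> 5"
    then consider "c = 1" | "c = 2" | "c = 3" | "c = 4"
      using c by blast
    then show False
    proof cases
      case 1
      then have "r i = 4 \<or> r i = 5" if "i < 3" for i
        using rng[OF that] by auto
      then have "(r i = 4) \<noteq> (r j = 4)" if "i < 3" "j < 3" "i \<noteq> j" for i j
        using dist that by metis
      then show False
        by (rule two_alike)
    next
      case 2
      then have "r i = 3 \<or> r i = 5" if "i < 3" for i
        using rng[OF that] by auto
      then have "(r i = 3) \<noteq> (r j = 3)" if "i < 3" "j < 3" "i \<noteq> j" for i j
        using dist that by metis
      then show False
        by (rule two_alike)
    next
      case 3
      then have r: "r i = 1 \<or> r i = 2 \<or> r i = 4 \<or> r i = 5" if "i < 3" for i
        using rng[OF that] by auto
      \<comment> \<open>Distinct labels of equal parity would be 1, 5 or 2, 4, with sum 2 * c =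
        6.\<close>
      have "even (r i) \<noteq> even (r j)" if "i < 3" "j < 3" "i \<noteq> j" for i j
        using r[OF that(1)] r[OF that(2)] dist[OF that] sums[OF that] 3 by (elim disjE) simp_all
      then show False
        by (rule two_alike)
    next
      case 4
      then have r: "r i = 1 \<or> r i = 3 \<or> r i = 5" if "i < 3" for i
        using rng[OF that] by auto
      \<comment> \<open>3 and 5 cannot both occur, as their sum is 2 * c = 8.\<close>
      have "(r i = 1) \<noteq> (r j = 1)" if "i < 3" "j < 3" "i \<noteq> j" for i j
        using r[OF that(1)] r[OF that(2)] dist[OF that] sums[OF that] 4 by (elim disjE) simp_all
      then show False
        by (rule two_alike)
    qed
  qed
  \<comment> \<open>No label fits between 2 and 4: 1 is half of 2, 3 is the midpoint, and 5 is the
    hub label.\<close>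
  have pair: "{r i, r (Suc i mod 3)} \<noteq> {2, 4}" if "i < 3" for i
  proof
    assume eq: "{r i, r (Suc i mod 3)} = {2, 4}"
    have "0 < s i" "s i \<le> k" "compatible (r i) (s i)" "compatible (r (Suc i mod 3)) (s i)"
      "no_midpoint (r i) (s i) (r (Suc i mod 3))" "no_midpoint c (r i) (s i)"
      "no_midpoint c (r (Suc i mod 3)) (s i)"
      using l that by (simp_all add: gear_labels_def)
    moreover from this have "s i = 1 \<or> s i = 2 \<or> s i = 3 \<or> s i = 4 \<or> s i = 5"
      using k by linarith
    moreover have "r i = 2 \<and> r (Suc i mod 3) = 4 \<or> r i = 4 \<and> r (Suc i mod 3) = 2"
      using eq by (simp add: doubleton_eq_iff)
    ultimately show False
      using c5 by (elim disjE conjE) (simp_all add: compatible_def no_midpoint_def)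
  qed
  have r: "r i = 1 \<or> r i = 2 \<or> r i = 4" if "i < 3" for i
    using rng[OF that] c5 by auto
  have "(r i = 1) \<noteq> (r j = 1)" if ij: "i < 3" "j < 3" "i \<noteq> j" for i j
  proof -
    have "i = 0 \<or> i = 1 \<or> i = 2" "j = 0 \<or> j = 1 \<or> j = 2"
      using ij by linarith+
    \<comment> \<open>On a triangle any two vertices are adjacent, so \<open>pair\<close> applies to
      all pairs.\<close>
    then have "j = Suc i mod 3 \<or> i = Suc j mod 3"
      using \<open>i \<noteq> j\<close> by (elim disjE) simp_all
    then have "{r i, r j} \<noteq> {2, 4}"
      using pair[OF ij(1)] pair[OF ij(2)] by (auto simp: insert_commute)
    then show ?thesis
      using r[OF ij(1)] r[OF ij(2)] dist[OF ij] by (elim disjE) (simp_all add: insert_commute)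
  qed
  then show False
    by (rule two_alike)
qed

subsection \<open>Constructions\<close>

text \<open>The gears with 4 \<le> n \<le> 9, where k < 11 is too small for the greedy choice. All
  quantifiers are bounded, so evaluation decides the conditions.\<close>

lemma gear_labels_small:
  "gear_labels 3 6 6 ((!) [2, 4, 5]) ((!) [5, 1, 3])"
  "gear_labels 4 6 6 ((!) [1, 2, 5, 4]) ((!) [5, 3, 1, 3])"
  "gear_labels 5 7 7 ((!) [1, 2, 3, 5, 4]) ((!) [3, 5, 2, 6, 5])"
  "gear_labels 6 7 7 ((!) [1, 2, 3, 6, 5, 4]) ((!) [3, 5, 2, 1, 6, 5])"
  "gear_labels 7 9 9 ((!) [1, 2, 3, 4, 5, 6, 7]) ((!) [3, 5, 7, 3, 2, 1, 6])"
  "gear_labels 8 9 9 ((!) [1, 2, 3, 4, 5, 6, 7, 8]) ((!) [3, 5, 7, 3, 2, 1, 2, 5])"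
  unfolding gear_labels_def compatible_def no_midpoint_def by code_simp+

text \<open>Rim labels 1, ..., m below the hub label k have pairwise sums below 2 * k, and the odd k
  is no double. Each subdivision label is then chosen given only the previous one.\<close>

lemma gear_labels_large:
  assumes m: "2 \<le> m" "m < k" and k: "odd k" "11 \<le> k"
  shows "\<exists>s. gear_labels m k k Suc s"
proof -
  \<comment> \<open>The label of the rim vertex after \<open>i\<close>. The recursive choice runs
    over all naturals, so \<open>r'\<close> is defined beyond m too and wraps only at i = m -
    1.\<close>
  define r' where "r' i = (if Suc i = m then 1 else Suc (Suc i))" for i
  \<comment> \<open>Next to the rim label \<open>x\<close>, both \<open>2 * x\<close> and the reflection \<open>2 * x - k\<close> of the hub label are
    excluded, but only one of the two lies in \<open>{1..<k}\<close>.\<close>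
  define D where "D x = (if 2 * x < k then 2 * x else 2 * x - k)" for x
  define P where "P i x \<longleftrightarrow> 0 < x \<and> x < k \<and> compatible (Suc i) x \<and> compatible (r' i) x \<and>
    no_midpoint (Suc i) x (r' i) \<and> no_midpoint k (Suc i) x \<and> no_midpoint k (r' i) x \<and>
    (x = 3 \<longleftrightarrow> i = 0)" for i x
  have "\<exists>s. \<forall>i. P i (s i) \<and> no_midpoint (s i) (Suc (Suc i)) (s (Suc i))"
  proof (rule dependent_nat_choice)
    have "P 0 3"
      using m k by (auto simp: P_def r'_def compatible_def no_midpoint_def)
    then show "\<exists>x. P 0 x" ..
  next
    fix x i assume "P i x"
    define j where "j = Suc i"
    \<comment> \<open>Excluding 3 from all later choices lets the circuit close up at the first subdivision vertex.\<close>
    \<comment> \<open>At most one of the halves of the two rim labels and their mean is an integer,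
      namely \<open>(j + 2) div 2\<close>.\<close>
    let ?F = "{3, Suc j, r' j, D (Suc j), D (r' j), (j + 2) div 2, x, 2 * Suc j - x}"
    have "card ?F \<le> 8"
      by (intro order.trans[OF card_length[of "[_, _, _, _, _, _, _, _]"], simplified]) auto
    then have "card ?F < card {1..<k}"
      using k by simp
    then have "\<not> {1..<k} \<subseteq> ?F"
      using card_mono[of ?F "{1..<k}"] by auto
    then obtain y where y: "y \<in> {1..<k}" "y \<notin> ?F"
      by blast
    then have ne: "0 < y" "y < k" "y \<noteq> 3" "y \<noteq> Suc j" "y \<noteq> r' j" "y \<noteq> D (Suc j)"
      "y \<noteq> D (r' j)" "y \<noteq> (j + 2) div 2" "y \<noteq> x" "y \<noteq> 2 * Suc j - x"
      by auto
    have D: "y \<noteq> 2 * z \<and> k + y \<noteq> 2 * z" if "y \<noteq> D z" for z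
      using that ne(2) by (auto simp: D_def split: if_splits)
    have half: "Suc j \<noteq> 2 * y \<and> r' j \<noteq> 2 * y \<and> Suc j + r' j \<noteq> 2 * y"
    proof -
      have "2 * y \<noteq> Suc j" "2 * y \<noteq> Suc (Suc j)"
        using ne(8) by linarith+
      moreover have "2 * y \<noteq> 1" "2 * y \<noteq> Suc j + Suc (Suc j)"
        by arith+
      ultimately show ?thesis
        by (simp add: r'_def eq_commute[of _ "2 * y"])
    qed
    have "Suc j \<noteq> r' j"
      using m by (auto simp: r'_def)
    then have "compatible (Suc j) y" "compatible (r' j) y" "no_midpoint (Suc j) y (r' j)"
      "no_midpoint k (Suc j) y" "no_midpoint k (r' j) y"
      using ne(2,4,5) D[OF ne(6)] D[OF ne(7)] half
      unfolding compatible_def no_midpoint_def by (metis less_irrefl)+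
    then have "P j y"
      using ne(1-3) by (simp add: P_def j_def)
    \<comment> \<open>Uses the last two entries of \<open>?F\<close>: the previous label and its
      reflection in the rim label between. If the subtraction truncates, no positive y is the
      reflection.\<close>
    moreover have "no_midpoint x (Suc (Suc i)) y"
      using ne(9,10) unfolding no_midpoint_def j_def by (metis add_diff_cancel_left')
    ultimately show "\<exists>y. P (Suc i) y \<and> no_midpoint x (Suc (Suc i)) y"
      by (auto simp: j_def)
  qed
  then obtain s where P: "\<And>i. P i (s i)" and S: "\<And>i. no_midpoint (s i) (Suc (Suc i)) (s (Suc i))"
    by blast
  have r': "Suc (Suc i mod m) = r' i" if "i < m" for i
    using that m by (auto simp: r'_def)
  have "no_midpoint (s i) (r' i) (s (Suc i mod m))" if "i < m" for i
  proof (cases "Suc i = m")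
    \<comment> \<open>The circuit closes at rim label 1, followed by the label 3. A sum of at least
      4 is never 2 * 1, so only \<open>s i\<close> \<noteq> 3 matters, and i \<noteq> 0 gives
      it.\<close>
    case True
    then show ?thesis
      using P[of 0] P[of i] m by (auto simp: P_def r'_def no_midpoint_def)
  next
    case False
    then show ?thesis
      using S[of i] that by (auto simp: r'_def)
  qed
  moreover have "compatible k (Suc i)" if "i < m" for i
    using that m k by (auto simp: compatible_def)
  moreover have "no_midpoint (Suc i) k (Suc j)" if "i < m" "j < i" for i j
    using that m by (auto simp: no_midpoint_def)
  ultimately have "gear_labels m k k Suc s"
    unfolding gear_labels_def using m P by (auto simp: r' P_def less_imp_le)
  then show ?thesis
    by blast
qed

theorem theorem5p2:
  fixes n :: nat
  assumes "n \<ge> 4"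
  shows "total_difference_chromatic_number (gear_graph n) =
    (if n = 4 \<or> n = 5 then 6 else if even n then n + 1 else n)"
proof -
  let ?k = "if n = 4 \<or> n = 5 then 6 else if even n then n + 1 else n"
  have "\<exists>c r s. gear_labels (n - 1) ?k c r s"
  proof (cases "n \<le> 9")
    case True
    then have "n = 4 \<or> n = 5 \<or> n = 6 \<or> n = 7 \<or> n = 8 \<or> n = 9"
      using assms by auto
    then show ?thesis
      using gear_labels_small by (elim disjE) (simp, blast)+
  next
    case False
    then have "odd ?k" "11 \<le> ?k"
      by (auto elim!: oddE)
    then have "\<exists>s. gear_labels (n - 1) ?k ?k Suc s"
      using assms by (intro gear_labels_large) auto
    then show ?thesis
      by blast
  qed
  moreover have "?k \<le> k" if l: "gear_labels (n - 1) k c r s" for k c r s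
  proof -
    have "6 \<le> k" if "n = 4 \<or> n = 5"
      using that l gear_labels_3_ge gear_labels_4_ge by auto
    moreover have "n + 1 \<le> k" if "even n"
      using that assms gear_labels_odd_ge[OF l] by simp
    moreover have "n \<le> k"
      using assms gear_labels_ge[OF l] by simp
    ultimately show ?thesis
      by simp
  qed
  ultimately show ?thesis
    using total_difference_chromatic_number_gear_eqI[OF assms] by blast
qed

end
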